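(* Let $0<p<1$ and let $\zeta$ be the random substitution on $\{a,b\}$ which maps each of the letters $a$ and $b$ to $ab$ with probability $p$ and to $ba$ with probability $1-p$. If $\mu=\mu_\zeta$ denotes the corresponding frequency measure on $\mathbb X_\zeta$, then its metric entropy $h_\mu$ (with respect to the shift) is $$h_\mu=-\tfrac12\bigl(p\log(p)+(1-p)\log(1-p)\bigr).$$
   Context: Words. $\mathcal A$ is a finite alphabet, $\mathcal A^+=\bigcup_{n\ge 1}\mathcal A^n$ is the set of non-empty finite words, $|u|$ is the length of $u$, $u_{[k,m]}=u_k\cdots u_m$, and $|u|_v$ is the number of (possibly overlapping) occurrences of $v$ as a subword of $u$; $v\triangleleft u$ means $|u|_v\ge 1$. Random substitution. A random substitution $\vartheta$ on $\mathcal A$ is determined by a map $a\mapsto P^\vartheta_a$ assigning to each $a\in\mathcal A$ a finitely supported probability measure on $\mathcal A^+$ ("$a$ is mapped to $w$ with probability $P^\vartheta_a(w)$"). The transition kernel is $P(u_1\cdots u_m,v)=\sum_{v^1\cdots v^m=v}P^\vartheta_{u_1}(v^1)\cdots P^\vartheta_{u_m}(v^m)$ (sum over $v^1,\dots,v^m\in\mathcal A^+$ with concatenation $v$). For $u=u_1\cdots u_m\in\mathcal A^+$, $(\vartheta^n(u))_{n\ge 0}$ is the Markov chain on $\mathcal A^+$ with $\vartheta^0(u)=u$ and transition kernel $P$; it is realised on one probability space so that $\vartheta^n(u)=\vartheta^n(u_1)\cdots\vartheta^n(u_m)$ pointwise for all $n$, where $(\vartheta^n(u_1))_n,\dots,(\vartheta^n(u_m))_n$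 are independent Markov chains with kernel $P$ started at the letters $u_1,\dots,u_m$. The mean substitution matrix is $(M_\vartheta)_{ab}=\mathbb E|\vartheta(b)|_a$, $a,b\in\mathcal A$. $\vartheta$ is primitive if $M_\vartheta$ is a primitive matrix; a primitive $\vartheta$ is expanding if $\mathbb P[|\vartheta(a)|>1]>0$ for some $a\in\mathcal A$. Language and subshift. $\mathcal L_\vartheta=\{u\in\mathcal A^+: u\triangleleft v \text{ for some } v \text{ with } \mathbb P[\vartheta^n(a)=v]>0 \text{ for some } n\in\mathbb N, a\in\mathcal A\}$, $\mathcal L_\vartheta^\ell$ is the set of elements of $\mathcal L_\vartheta$ of length $\ell$, and $\mathbb X_\vartheta=\{x\in\mathcal A^{\mathbb Z}: x_{[k,m]}\in\mathcal L_\vartheta\text{ for all }k\le m\}$. Induced matrix. For $\ell\in\mathbb N$ let $\mathcal A_\ell=\mathcal L_\vartheta^\ell$. For $u=u_1\cdots u_\ell\in\mathcal A_\ell$ define the random word over the alphabet $\mathcal A_\ell$, $\vartheta_\ell(u)=(\vartheta(u)_{[k,k+\ell-1]})_{1\le k\le|\vartheta(u_1)|}$, and let $(M_{\vartheta_\ell})_{uv}=\mathbb E|\vartheta_\ell(v)|_u$ for $u,v\in\mathcal A_\ell$. It is known that for expanding primitive $\vartheta$ the matrix $M_{\vartheta_\ell}$ is primitive with the same Perron–Frobenius eigenvalue $\lambda$ as $M_\vartheta$. $R^{(\ell)}$ denotes its right Perron–Frobenius eigenvector with $\|R^{(\ell)}\|_1=1$. Frequency measure. $\mathcal Z_{[k,m]}(v)=\{x\in\mathbb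 X_\vartheta:x_{[k,m]}=v\}$ for $k\le m$, $v\in\mathcal L_\vartheta^{m-k+1}$. For expanding primitive $\vartheta$, $\mu_\vartheta$ is the unique (shift-invariant) Borel probability measure on $\mathbb X_\vartheta$ with $\mu_\vartheta(\mathcal Z_{[k,m]}(v))=R^{(m-k+1)}_v$ for all $k\le 0\le m$ and $v\in\mathcal L_\vartheta^{m-k+1}$. Its metric entropy is $h_\mu=\lim_{n\to\infty}-\frac1n\sum_{w\in\mathcal L_\vartheta^n}\mu([w])\log\mu([w])$, where $[w]=\{x\in\mathbb X_\vartheta: x_{[0,n-1]}=w\}$. *)

theory Defs
  imports "HOL-Probability.Probability" "HOL-Library.Sublist"
begin

section \<open>Random substitutions\<close>

text \<open>A random substitution is a map \<open>\<theta> :: 'a \<Rightarrow> 'a list pmf\<close> on a finite type of letters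
  satisfying the following predicate.\<close>

definition random_substitution :: "('a::finite \<Rightarrow> 'a list pmf) \<Rightarrow> bool" where
  "random_substitution \<theta> \<longleftrightarrow> (\<forall>a. finite (set_pmf (\<theta> a)) \<and> [] \<notin> set_pmf (\<theta> a))"

text \<open>Joint law of the tuple \<open>(\<theta>(u\<^sub>1), \<dots>, \<theta>(u\<^sub>m))\<close> of independent images. The factorisation
  of \<open>\<theta>(u)\<close> has to be recorded, since the induced substitution below depends on both
  \<open>\<theta>(u)\<close> and the length of \<open>\<theta>(u\<^sub>1)\<close>.\<close>

primrec letter_images :: "('a \<Rightarrow> 'a list pmf) \<Rightarrow> 'a list \<Rightarrow> 'a list list pmf" where
  "letter_images \<theta> [] = return_pmf []"
| "letter_images \<theta> (a # u) = map_pmf (\<lambda>(w, ws). w # ws) (pair_pmf (\<theta> a) (letter_images \<theta> u))"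

text \<open>The transition kernel: \<open>pmf (subst_word \<theta> u) v\<close> is \<open>P(u, v)\<close>.\<close>

definition subst_word :: "('a \<Rightarrow> 'a list pmf) \<Rightarrow> 'a list \<Rightarrow> 'a list pmf" where
  "subst_word \<theta> u = map_pmf concat (letter_images \<theta> u)"

text \<open>Law of the \<open>n\<close>-th step of the Markov chain started at \<open>u\<close>.\<close>

primrec subst_iter :: "('a \<Rightarrow> 'a list pmf) \<Rightarrow> nat \<Rightarrow> 'a list \<Rightarrow> 'a list pmf" where
  "subst_iter \<theta> 0 u = return_pmf u"
| "subst_iter \<theta> (Suc n) u = bind_pmf (subst_iter \<theta> n u) (subst_word \<theta>)"


section \<open>Matrices over a finite index set and Perron--Frobenius data\<close>

text \<open>Matrices are functions \<open>'i \<Rightarrow> 'i \<Rightarrow> real\<close> considered on a finite set of indices, because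
  the induced matrices below are indexed by the legal words of a given length.\<close>

primrec mat_power :: "'i set \<Rightarrow> ('i \<Rightarrow> 'i \<Rightarrow> real) \<Rightarrow> nat \<Rightarrow> 'i \<Rightarrow> 'i \<Rightarrow> real" where
  "mat_power I M 0 i j = (if i = j then 1 else 0)"
| "mat_power I M (Suc n) i j = (\<Sum>k\<in>I. mat_power I M n i k * M k j)"

definition primitive_matrix :: "'i set \<Rightarrow> ('i \<Rightarrow> 'i \<Rightarrow> real) \<Rightarrow> bool" where
  "primitive_matrix I M \<longleftrightarrow>
     (\<forall>i\<in>I. \<forall>j\<in>I. M i j \<ge> 0) \<and> (\<exists>n\<ge>1. \<forall>i\<in>I. \<forall>j\<in>I. mat_power I M n i j > 0)"

definition mat_eigenvalue :: "'i set \<Rightarrow> ('i \<Rightarrow> 'i \<Rightarrow> real) \<Rightarrow> complex \<Rightarrow> bool" where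
  "mat_eigenvalue I M z \<longleftrightarrow>
     (\<exists>x. (\<exists>i\<in>I. x i \<noteq> 0) \<and> (\<forall>i\<in>I. (\<Sum>j\<in>I. complex_of_real (M i j) * x j) = z * x i))"

text \<open>The Perron--Frobenius eigenvalue of a primitive matrix is its spectral radius.\<close>

definition pf_eigenvalue :: "'i set \<Rightarrow> ('i \<Rightarrow> 'i \<Rightarrow> real) \<Rightarrow> real" where
  "pf_eigenvalue I M = Sup (cmod ` {z. mat_eigenvalue I M z})"

definition right_pf_eigenvector :: "'i set \<Rightarrow> ('i \<Rightarrow> 'i \<Rightarrow> real) \<Rightarrow> ('i \<Rightarrow> real) \<Rightarrow> bool" where
  "right_pf_eigenvector I M R \<longleftrightarrow>
     (\<forall>i\<in>I. R i > 0) \<and>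
     (\<forall>i\<in>I. (\<Sum>j\<in>I. M i j * R j) = pf_eigenvalue I M * R i) \<and>
     (\<Sum>i\<in>I. \<bar>R i\<bar>) = 1"


section \<open>Mean matrix, primitivity, language and subshift\<close>

definition mean_matrix :: "('a \<Rightarrow> 'a list pmf) \<Rightarrow> 'a \<Rightarrow> 'a \<Rightarrow> real" where
  "mean_matrix \<theta> a b = measure_pmf.expectation (\<theta> b) (\<lambda>w. real (count_list w a))"

definition primitive_subst :: "('a::finite \<Rightarrow> 'a list pmf) \<Rightarrow> bool" where
  "primitive_subst \<theta> \<longleftrightarrow> primitive_matrix UNIV (mean_matrix \<theta>)"

definition expanding_subst :: "('a::finite \<Rightarrow> 'a list pmf) \<Rightarrow> bool" where
  "expanding_subst \<theta> \<longleftrightarrow> (\<exists>a. measure_pmf.prob (\<theta> a) {w. length w > 1} > 0)"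

definition language :: "('a \<Rightarrow> 'a list pmf) \<Rightarrow> 'a list set" where
  "language \<theta> =
     {u. u \<noteq> [] \<and> (\<exists>n\<ge>1. \<exists>a v. pmf (subst_iter \<theta> n [a]) v > 0 \<and> sublist u v)}"

definition language_len :: "('a \<Rightarrow> 'a list pmf) \<Rightarrow> nat \<Rightarrow> 'a list set" where
  "language_len \<theta> l = {u \<in> language \<theta>. length u = l}"

definition subshift :: "('a \<Rightarrow> 'a list pmf) \<Rightarrow> (int \<Rightarrow> 'a) set" where
  "subshift \<theta> = {x. \<forall>k m. k \<le> m \<longrightarrow> map x [k..m] \<in> language \<theta>}"

definition cylinder :: "('a \<Rightarrow> 'a list pmf) \<Rightarrow> int \<Rightarrow> int \<Rightarrow> 'a list \<Rightarrow> (int \<Rightarrow> 'a) set" where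
  "cylinder \<theta> k m v = {x \<in> subshift \<theta>. map x [k..m] = v}"


section \<open>Induced substitution\<close>

text \<open>Law of \<open>\<theta>\<^sub>l(u)\<close>: the windows of length \<open>l\<close> in \<open>\<theta>(u)\<close> that start inside \<open>\<theta>(u\<^sub>1)\<close>.\<close>

definition induced_subst :: "('a \<Rightarrow> 'a list pmf) \<Rightarrow> nat \<Rightarrow> 'a list \<Rightarrow> 'a list list pmf" where
  "induced_subst \<theta> l u =
     map_pmf (\<lambda>ws. map (\<lambda>k. take l (drop k (concat ws))) [0..<length (hd ws)])
       (letter_images \<theta> u)"

definition induced_matrix :: "('a \<Rightarrow> 'a list pmf) \<Rightarrow> nat \<Rightarrow> 'a list \<Rightarrow> 'a list \<Rightarrow> real" where
  "induced_matrix \<theta> l u v =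
     measure_pmf.expectation (induced_subst \<theta> l v) (\<lambda>w. real (count_list w u))"


section \<open>Frequency measure and metric entropy\<close>

definition subshift_topology :: "('a \<Rightarrow> 'a list pmf) \<Rightarrow> (int \<Rightarrow> 'a) topology" where
  "subshift_topology \<theta> =
     subtopology (product_topology (\<lambda>_. discrete_topology UNIV) UNIV) (subshift \<theta>)"

definition subshift_borel :: "('a \<Rightarrow> 'a list pmf) \<Rightarrow> (int \<Rightarrow> 'a) measure" where
  "subshift_borel \<theta> = sigma (subshift \<theta>) {U. openin (subshift_topology \<theta>) U}"

definition left_shift :: "(int \<Rightarrow> 'a) \<Rightarrow> int \<Rightarrow> 'a" where
  "left_shift x = (\<lambda>i. x (i + 1))"

text \<open>\<open>frequency_measure \<theta> \<mu>\<close> says that \<open>\<mu>\<close> is the frequency measure of the expanding primitive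
  random substitution \<open>\<theta>\<close>. It is characterised by its values on the cylinders around the
  origin; shift invariance is a consequence, but is part of the notion.\<close>

definition frequency_measure :: "('a::finite \<Rightarrow> 'a list pmf) \<Rightarrow> (int \<Rightarrow> 'a) measure \<Rightarrow> bool" where
  "frequency_measure \<theta> \<mu> \<longleftrightarrow>
     random_substitution \<theta> \<and> primitive_subst \<theta> \<and> expanding_subst \<theta> \<and>
     prob_space \<mu> \<and> sets \<mu> = sets (subshift_borel \<theta>) \<and>
     distr \<mu> \<mu> left_shift = \<mu> \<and>
     (\<exists>R :: nat \<Rightarrow> 'a list \<Rightarrow> real.
        (\<forall>l\<ge>1. right_pf_eigenvector (language_len \<theta> l) (induced_matrix \<theta> l) (R l)) \<and>
        (\<forall>k m v. k \<le> 0 \<longrightarrow> 0 \<le> m \<longrightarrow> v \<in> language_len \<theta> (nat (m - k + 1)) \<longrightarrow>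
           measure \<mu> (cylinder \<theta> k m v) = R (nat (m - k + 1)) v))"

definition block_entropy :: "('a \<Rightarrow> 'a list pmf) \<Rightarrow> (int \<Rightarrow> 'a) measure \<Rightarrow> nat \<Rightarrow> real" where
  "block_entropy \<theta> \<mu> n =
     - (\<Sum>w\<in>language_len \<theta> n.
          measure \<mu> (cylinder \<theta> 0 (int n - 1) w) * ln (measure \<mu> (cylinder \<theta> 0 (int n - 1) w)))"

text \<open>The limit defining the metric entropy exists and has value \<open>h\<close>.\<close>

definition has_metric_entropy ::
    "('a \<Rightarrow> 'a list pmf) \<Rightarrow> (int \<Rightarrow> 'a) measure \<Rightarrow> real \<Rightarrow> bool" where
  "has_metric_entropy \<theta> \<mu> h \<longleftrightarrow> (\<lambda>n. block_entropy \<theta> \<mu> n / real n) \<longlonglongrightarrow> h"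


section \<open>The substitution \<open>a, b \<mapsto> ab\<close> or \<open>ba\<close>\<close>

datatype letter = LA | LB

lemma UNIV_letter: "UNIV = {LA, LB}"
  using letter.exhaust by auto

instance letter :: finite
  by standard (simp add: UNIV_letter)

definition zeta :: "real \<Rightarrow> letter \<Rightarrow> letter list pmf" where
  "zeta p x = map_pmf (\<lambda>c. if c then [LA, LB] else [LB, LA]) (bernoulli_pmf p)"

lemma set_zeta: "set_pmf (zeta p x) \<subseteq> {[LA, LB], [LB, LA]}"
  by (auto simp: zeta_def)

lemma random_substitution_zeta: "random_substitution (zeta p)"
  unfolding random_substitution_def
  using set_zeta[of p] by (auto intro: finite_subset)

lemma mean_matrix_zeta: "mean_matrix (zeta p) x y = 1"
proof -
  have "mean_matrix (zeta p) x y = measure_pmf.expectation (zeta p y) (\<lambda>_. 1)"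
    unfolding mean_matrix_def
    by (intro integral_cong_AE) (use set_zeta[of p y] in \<open>cases x; auto simp: AE_measure_pmf_iff\<close>)+
  then show ?thesis by simp
qed

lemma primitive_subst_zeta: "primitive_subst (zeta p)"
  unfolding primitive_subst_def primitive_matrix_def
  by (auto simp: mean_matrix_zeta UNIV_letter intro!: exI[of _ 1])

lemma expanding_subst_zeta: "expanding_subst (zeta p)"
proof -
  have "measure_pmf.prob (zeta p LA) {w. length w > 1} = 1"
    using set_zeta[of p LA] by (subst measure_pmf.prob_eq_1) (auto simp: AE_measure_pmf_iff)
  then show ?thesis unfolding expanding_subst_def by (intro exI[of _ LA]) simp
qed

end

theory Submission imports Defs "HOL-Real_Asymp.Real_Asymp" begin

text \<open>Every letter has the same image law, so the \<open>\<zeta>\<close>-image of a word of length \<open>l\<close> is a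
  concatenation of \<open>l\<close> i.i.d. blocks \<open>ab\<close> or \<open>ba\<close>, whatever the word. Hence all columns of
  the induced matrix agree, and its normalised right Perron--Frobenius eigenvector is the equal
  mixture of the laws of the windows of length \<open>l\<close> that start at the first and at the second
  letter of such a concatenation. Each letter of a block determines the block, so these two
  windows encode injectively \<open>\<lceil>l/2\<rceil>\<close> and \<open>\<lfloor>l/2\<rfloor> + 1\<close> independent Bernoulli
  bits. Their entropies add up to \<open>l + 1\<close> times that of one bit, and the entropy of the
  mixture differs from the mean of the two by at most \<open>ln 2\<close>.\<close>


section \<open>Shannon entropy of finitely supported distributions\<close>

definition pmf_entropy :: "'a pmf \<Rightarrow> real" where
  "pmf_entropy P = (\<Sum>x\<in>set_pmf P. - (pmf P x * ln (pmf P x)))"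

text \<open>Points outside the support contribute \<open>0 * ln 0 = 0\<close>. This allows laws with
  different supports to be summed over one common index set.\<close>

lemma pmf_entropy_superset:
  assumes "finite A" "set_pmf P \<subseteq> A"
  shows "pmf_entropy P = (\<Sum>x\<in>A. - (pmf P x * ln (pmf P x)))"
  unfolding pmf_entropy_def
  using assms by (intro sum.mono_neutral_left) (auto simp: set_pmf_iff)

lemma pmf_entropy_map_inj:
  assumes "inj_on f (set_pmf P)"
  shows "pmf_entropy (map_pmf f P) = pmf_entropy P"
  unfolding pmf_entropy_def
  using assms by (simp add: sum.reindex pmf_map_inj)

lemma pmf_entropy_return [simp]: "pmf_entropy (return_pmf x) = 0"
  by (simp add: pmf_entropy_def)

lemma pmf_entropy_pair:
  assumes "finite (set_pmf P)" "finite (set_pmf Q)"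
  shows "pmf_entropy (pair_pmf P Q) = pmf_entropy P + pmf_entropy Q"
proof -
  have sum1: "(\<Sum>x\<in>set_pmf P. pmf P x) = 1" "(\<Sum>x\<in>set_pmf Q. pmf Q x) = 1"
    using assms by (simp_all add: sum_pmf_eq_1)
  have "pmf_entropy (pair_pmf P Q) =
      (\<Sum>x\<in>set_pmf P. \<Sum>y\<in>set_pmf Q. - (pmf P x * pmf Q y * ln (pmf P x * pmf Q y)))"
    by (simp add: pmf_entropy_def pmf_pair sum.cartesian_product')
  also have "\<dots> = (\<Sum>x\<in>set_pmf P. \<Sum>y\<in>set_pmf Q.
      - (pmf P x * ln (pmf P x)) * pmf Q y + pmf P x * - (pmf Q y * ln (pmf Q y)))"
    by (intro sum.cong refl) (simp add: ln_mult pmf_positive_iff[symmetric] algebra_simps)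
  also have "\<dots> = (\<Sum>x\<in>set_pmf P. - (pmf P x * ln (pmf P x))) * (\<Sum>y\<in>set_pmf Q. pmf Q y)
      + (\<Sum>x\<in>set_pmf P. pmf P x) * (\<Sum>y\<in>set_pmf Q. - (pmf Q y * ln (pmf Q y)))"
    by (simp only: sum.distrib sum_product)
  finally show ?thesis
    using sum1 by (simp add: pmf_entropy_def)
qed

lemma pmf_entropy_replicate:
  assumes "finite (set_pmf P)"
  shows "pmf_entropy (replicate_pmf n P) = real n * pmf_entropy P"
proof (induction n)
  case (Suc n)
  have "replicate_pmf (Suc n) P = map_pmf (\<lambda>(x, xs). x # xs) (pair_pmf P (replicate_pmf n P))"
    by (simp add: map_pmf_def pair_pmf_def bind_assoc_pmf bind_return_pmf)
  moreover have "finite (set_pmf (replicate_pmf n P))"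
    using assms by (simp add: set_replicate_pmf finite_lists_length_eq lists_eq_set)
  ultimately show ?case
    using Suc assms
    by (simp add: pmf_entropy_map_inj inj_on_def pmf_entropy_pair algebra_simps)
qed simp

lemma pmf_entropy_bernoulli:
  assumes "0 < p" "p < 1"
  shows "pmf_entropy (bernoulli_pmf p) = - (p * ln p + (1 - p) * ln (1 - p))"
  using assms by (simp add: pmf_entropy_def UNIV_bool)

section \<open>Entropy of an equal mixture of two laws\<close>

text \<open>Midpoint concavity of \<open>- x * ln x\<close>, with the value \<open>0\<close> at
  \<open>0\<close>.\<close>

lemma xlnx_mean_le:
  fixes x y :: real
  assumes "0 \<le> x" "0 \<le> y"
  shows "(- (x * ln x) - y * ln y) / 2 \<le> - ((x + y) / 2 * ln ((x + y) / 2))"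
proof (cases "x + y = 0")
  case False
  define m where "m = (x + y) / 2"
  have m: "m > 0" using False assms by (simp add: m_def)
  \<comment> \<open>This is \<open>ln t \<le> t - 1\<close> at \<open>t = m / z\<close>, multiplied
    by \<open>z\<close>. Adding the cases \<open>z = x\<close> and \<open>z = y\<close> makes the
    right-hand sides cancel, since \<open>x + y = 2 * m\<close>.\<close>
  have tangent: "z * ln m - z * ln z \<le> m - z" if "0 \<le> z" for z
  proof (cases "z = 0")
    case False
    then have "z > 0" using that by simp
    have "ln (m / z) \<le> m / z - 1"
      using m \<open>z > 0\<close> by (intro ln_le_minus_one) simp
    then have "z * (ln m - ln z) \<le> z * (m / z - 1)"
      using m \<open>z > 0\<close> by (intro mult_left_mono) (simp_all add: ln_div)
    then show ?thesis using \<open>z > 0\<close> by (simp add: algebra_simps)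
  qed (use m in simp)
  have "x * ln m + y * ln m = 2 * (m * ln m)"
    by (simp add: m_def algebra_simps add_divide_distrib)
  moreover have "x + y = 2 * m" by (simp add: m_def)
  ultimately show ?thesis
    using tangent[OF assms(1)] tangent[OF assms(2)] by (simp flip: m_def)
qed (use assms in \<open>simp add: add_nonneg_eq_0_iff\<close>)

text \<open>Each of \<open>x\<close> and \<open>y\<close> is at most twice the mean, so its
  logarithm exceeds that of the mean by at most \<open>ln 2\<close>. Summed over a mixture, the
  error terms add up to \<open>ln 2\<close>.\<close>

lemma xlnx_mean_ge:
  fixes x y :: real
  assumes "0 \<le> x" "0 \<le> y"
  shows "- ((x + y) / 2 * ln ((x + y) / 2)) \<le>
    (- (x * ln x) - y * ln y) / 2 + (x + y) / 2 * ln 2"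
proof -
  define m where "m = (x + y) / 2"
  have bound: "z * ln z - z * ln 2 \<le> z * ln m" if "0 \<le> z" "z \<le> 2 * m" for z
  proof (cases "z = 0")
    case False
    then have "z > 0" using that by simp
    then have "ln z \<le> ln (2 * m)" using that by simp
    also have "\<dots> = ln 2 + ln m" using \<open>z > 0\<close> that by (simp add: ln_mult)
    finally have "z * (ln z - ln 2) \<le> z * ln m"
      using \<open>z > 0\<close> by (intro mult_left_mono) simp_all
    then show ?thesis by (simp add: algebra_simps)
  qed simp
  have "x * ln m + y * ln m = 2 * (m * ln m)"
    by (simp add: m_def algebra_simps add_divide_distrib)
  moreover have "x * ln 2 + y * ln 2 = 2 * (m * ln 2)"
    by (simp add: m_def algebra_simps add_divide_distrib)
  ultimately show ?thesis
    using bound[of x] bound[of y] assms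
    by (simp flip: m_def) (simp add: m_def field_simps)
qed

text \<open>\<open>R\<close> is a mere function known on \<open>A\<close>, since the eigenvector to
  which this is applied is determined only on the legal words.\<close>

lemma entropy_mixture_bounds:
  assumes A: "finite A" "set_pmf P \<subseteq> A" "set_pmf Q \<subseteq> A"
    and R: "\<And>x. x \<in> A \<Longrightarrow> R x = (pmf P x + pmf Q x) / 2"
  shows "(pmf_entropy P + pmf_entropy Q) / 2 \<le> - (\<Sum>x\<in>A. R x * ln (R x))"
    and "- (\<Sum>x\<in>A. R x * ln (R x)) \<le> (pmf_entropy P + pmf_entropy Q) / 2 + ln 2"
proof -
  have PQ: "(pmf_entropy P + pmf_entropy Q) / 2 =
      (\<Sum>x\<in>A. (- (pmf P x * ln (pmf P x)) - pmf Q x * ln (pmf Q x)) / 2)"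
    using A by (simp add: pmf_entropy_superset[of A] sum_divide_distrib
        flip: sum.distrib sum_subtractf sum_negf)
  show "(pmf_entropy P + pmf_entropy Q) / 2 \<le> - (\<Sum>x\<in>A. R x * ln (R x))"
    unfolding PQ sum_negf[symmetric]
    using xlnx_mean_le[OF pmf_nonneg pmf_nonneg, of P _ Q] R
    by (intro sum_mono) (simp only:)
  have "(\<Sum>x\<in>A. (pmf P x + pmf Q x) / 2 * ln 2) = ln 2"
    using A by (simp add: sum_pmf_eq_1 sum.distrib flip: sum_divide_distrib sum_distrib_right)
  moreover have "- (\<Sum>x\<in>A. R x * ln (R x)) \<le>
      (\<Sum>x\<in>A. (- (pmf P x * ln (pmf P x)) - pmf Q x * ln (pmf Q x)) / 2
        + (pmf P x + pmf Q x) / 2 * ln 2)"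
    unfolding sum_negf[symmetric]
    using xlnx_mean_ge[OF pmf_nonneg pmf_nonneg, of P _ Q] R
    by (intro sum_mono) (simp only:)
  ultimately show "- (\<Sum>x\<in>A. R x * ln (R x)) \<le> (pmf_entropy P + pmf_entropy Q) / 2 + ln 2"
    unfolding PQ by (simp add: sum.distrib)
qed


section \<open>Words as sequences of blocks\<close>

definition block :: "bool \<Rightarrow> letter list" where
  "block c = (if c then [LA, LB] else [LB, LA])"

definition encode :: "bool list \<Rightarrow> letter list" where
  "encode bs = concat (map block bs)"

lemma length_block [simp]: "length (block c) = 2"
  by (simp add: block_def)

lemma encode_simps [simp]: "encode [] = []" "encode (c # bs) = block c @ encode bs"
  by (simp_all add: encode_def)

lemma encode_append: "encode (bs @ cs) = encode bs @ encode cs"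
  by (simp add: encode_def)

lemma length_encode [simp]: "length (encode bs) = 2 * length bs"
  by (induction bs) simp_all

text \<open>The block of \<open>True\<close> has \<open>LA\<close> at its even position, that of
  \<open>False\<close> at its odd one. Hence a letter together with the parity of its position
  reveals the bit.\<close>

lemma nth_encode:
  "j < 2 * length bs \<Longrightarrow> encode bs ! j = (if bs ! (j div 2) = even j then LA else LB)"
proof (induction bs arbitrary: j)
  case (Cons c bs)
  consider "j = 0" | "j = 1" | i where "j = Suc (Suc i)"
    by (metis One_nat_def not0_implies_Suc)
  then show ?case
  proof cases
    case 3
    then show ?thesis using Cons by (simp add: nth_append)
  qed (auto simp: block_def nth_append)
qed simp

definition window :: "nat \<Rightarrow> nat \<Rightarrow> bool list \<Rightarrow> letter list" where
  "window l k bs = take l (drop k (encode bs))"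

text \<open>The window ends at position \<open>k + l\<close>, within the first \<open>m\<close>
  blocks.\<close>

lemma window_take:
  assumes "k + l \<le> 2 * m"
  shows "window l k (take m bs) = window l k bs"
proof (cases "length bs \<le> m")
  case False
  have "encode bs = encode (take m bs) @ encode (drop m bs)"
    by (simp flip: encode_append)
  then show ?thesis
    using False assms by (simp add: window_def)
qed simp

text \<open>The bound \<open>2 * m \<le> k + l + 1\<close> says that the window meets the last of the \<open>m\<close> blocks;
  \<open>k \<le> 1\<close> that it meets the first one.\<close>

lemma inj_on_window:
  assumes "k \<le> 1" "0 < l" "k + l \<le> 2 * m" "2 * m \<le> k + l + 1"
  shows "inj_on (window l k) {bs. length bs = m}"
proof (rule inj_onI, clarsimp)
  fix bs cs :: "bool list"
  assume len: "length cs = length bs" "m = length bs"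
    and eq: "window l k bs = window l k cs"
  show "bs = cs"
  proof (rule nth_equalityI)
    fix i assume i: "i < length bs"
    \<comment> \<open>A position in block \<open>i\<close> visible through the window: the first
      letter of the block, except for \<open>i = 0\<close> and \<open>k = 1\<close>, where the
      window starts at the second letter.\<close>
    obtain j where j: "j div 2 = i" "k \<le> j" "j < k + l"
    proof (cases "k \<le> 2 * i")
      case True
      then show ?thesis using that[of "2 * i"] i len assms by simp
    next
      case False
      then show ?thesis using that[of "2 * i + 1"] i len assms by simp
    qed
    have "window l k ds ! (j - k) = encode ds ! j" if "length ds = length bs" for ds
      using that j assms len by (simp add: window_def)
    then have "encode bs ! j = encode cs ! j"
      using eq len by metis
    then show "bs ! i = cs ! i"
      using i j len by (simp add: nth_encode split: if_splits)
  qed (use len in simp)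
qed

text \<open>The image of a word of length \<open>l\<close> has \<open>l\<close> blocks, hence
  \<open>l\<close> bits for both offsets \<open>k\<close>; \<open>entropy_window_law\<close>
  restricts them to the blocks that the window meets.\<close>

definition window_law :: "real \<Rightarrow> nat \<Rightarrow> nat \<Rightarrow> letter list pmf" where
  "window_law p l k = map_pmf (window l k) (replicate_pmf l (bernoulli_pmf p))"

lemma map_take_replicate_pmf:
  "m \<le> n \<Longrightarrow> map_pmf (take m) (replicate_pmf n P) = replicate_pmf m P"
proof -
  assume "m \<le> n"
  then have "map_pmf (take m) (replicate_pmf n P) =
      map_pmf (take m) (replicate_pmf (m + (n - m)) P)"
    by simp
  also have "\<dots> = replicate_pmf m P \<bind>
      (\<lambda>xs. replicate_pmf (n - m) P \<bind> (\<lambda>ys. return_pmf (take m (xs @ ys))))"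
    by (simp only: replicate_pmf_distrib map_bind_pmf map_return_pmf)
  also have "\<dots> = replicate_pmf m P \<bind> return_pmf"
    by (intro bind_pmf_cong refl) (auto simp: set_replicate_pmf)
  finally show ?thesis
    by (simp add: bind_return_pmf')
qed

text \<open>The window meets exactly \<open>(k + l + 1) div 2\<close> blocks and is an injective
  function of their independent bits.\<close>

lemma entropy_window_law:
  assumes p: "0 < p" "p < 1" and k: "k \<le> 1" "0 < l"
  shows "pmf_entropy (window_law p l k) =
    real ((k + l + 1) div 2) * pmf_entropy (bernoulli_pmf p)"
proof -
  define m where "m = (k + l + 1) div 2"
  have m: "m \<le> l" "k + l \<le> 2 * m" "2 * m \<le> k + l + 1"
    using k by (auto simp: m_def)
  have "window_law p l k = map_pmf (window l k \<circ> take m) (replicate_pmf l (bernoulli_pmf p))"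
    using m by (simp add: window_law_def window_take comp_def)
  also have "\<dots> = map_pmf (window l k) (replicate_pmf m (bernoulli_pmf p))"
    using m by (simp add: map_take_replicate_pmf flip: pmf.map_comp)
  finally have "pmf_entropy (window_law p l k) = pmf_entropy (replicate_pmf m (bernoulli_pmf p))"
    using pmf_entropy_map_inj[OF inj_on_subset[OF inj_on_window[OF k m(2,3)]]]
    by (simp add: set_replicate_pmf subset_eq)
  then show ?thesis
    by (simp add: pmf_entropy_replicate m_def)
qed


section \<open>The induced matrix and the frequency measure\<close>

lemma letter_images_zeta:
  "letter_images (zeta p) u = map_pmf (map block) (replicate_pmf (length u) (bernoulli_pmf p))"
proof (induction u)
  case (Cons a u)
  then show ?case
    by (simp add: zeta_def block_def[abs_def] map_pmf_def pair_pmf_def bind_assoc_pmf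
        bind_return_pmf)
qed simp

lemma subst_word_zeta:
  "subst_word (zeta p) u = map_pmf encode (replicate_pmf (length u) (bernoulli_pmf p))"
  by (simp add: subst_word_def letter_images_zeta pmf.map_comp comp_def encode_def[abs_def])

text \<open>The image of the first letter has length 2, so the induced word consists of the windows
  at offsets 0 and 1, and the expected count of \<open>u\<close> is the sum of two
  probabilities.\<close>

lemma induced_matrix_zeta:
  assumes "length v = l" "0 < l"
  shows "induced_matrix (zeta p) l u v = pmf (window_law p l 0) u + pmf (window_law p l 1) u"
proof -
  let ?B = "replicate_pmf l (bernoulli_pmf p)"
  have fin: "finite (set_pmf ?B)"
    by (rule finite_subset[OF _ finite_lists_length_eq[of UNIV l]]) (auto simp: set_replicate_pmf)
  have "induced_matrix (zeta p) l u v = measure_pmf.expectation ?B (\<lambda>bs. real (count_list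
      (map (\<lambda>k. take l (drop k (encode bs))) [0..<length (hd (map block bs))]) u))"
    using assms by (simp add: induced_matrix_def induced_subst_def letter_images_zeta encode_def)
  also have "\<dots> = measure_pmf.expectation ?B
      (\<lambda>bs. indicator (window l 0 -` {u}) bs + indicator (window l 1 -` {u}) bs)"
  proof (intro integral_cong_AE)
    show "AE bs in measure_pmf ?B. real (count_list
        (map (\<lambda>k. take l (drop k (encode bs))) [0..<length (hd (map block bs))]) u) =
        indicator (window l 0 -` {u}) bs + indicator (window l 1 -` {u}) bs"
    proof (simp add: AE_measure_pmf_iff set_replicate_pmf, intro allI impI, elim conjE)
      fix bs :: "bool list" assume "length bs = l"
      then have "length (hd (map block bs)) = 2"
        using assms by (cases bs) auto
      then show "real (count_list
        (map (\<lambda>k. take l (drop k (encode bs))) [0..<length (hd (map block bs))]) u) =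
        indicator (window l 0 -` {u}) bs + indicator (window l (Suc 0) -` {u}) bs"
        by (simp add: window_def numeral_2_eq_2 indicator_def)
    qed
  qed simp_all
  also have "\<dots> = pmf (window_law p l 0) u + pmf (window_law p l 1) u"
    using fin by (simp add: window_law_def pmf_map
        integrable_measure_pmf_finite)
  finally show ?thesis .
qed

section \<open>Legal words and the Perron--Frobenius eigenvector\<close>

lemma length_subst_iter_zeta:
  "w \<in> set_pmf (subst_iter (zeta p) n [a]) \<Longrightarrow> length w = 2 ^ n"
  by (induction n arbitrary: w)
    (auto simp: subst_word_zeta set_replicate_pmf split: if_splits)

lemma sublist_encode_in_language:
  assumes p: "0 < p" "p < 1" and "u \<noteq> []" "sublist u (encode bs)"
  shows "u \<in> language (zeta p)"
proof -
  define n where "n = length bs"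
  \<comment> \<open>Words reached from a letter in \<open>n\<close> steps have length
    \<open>2 ^ n\<close>, which exceeds \<open>n\<close>; padding the bits to this length makes
    \<open>encode cs\<close> a possible image of such a word.\<close>
  define cs where "cs = bs @ replicate (2 ^ n - n) True"
  have len: "length cs = 2 ^ n"
    using less_exp[of n] by (simp add: cs_def n_def)
  obtain w where w: "w \<in> set_pmf (subst_iter (zeta p) n [LA])"
    using set_pmf_not_empty by fast
  have "cs \<in> set_pmf (replicate_pmf (length w) (bernoulli_pmf p))"
    using len length_subst_iter_zeta[OF w] p by (simp add: set_replicate_pmf)
  then have "encode cs \<in> set_pmf (subst_iter (zeta p) (Suc n) [LA])"
    using w by (auto simp: subst_word_zeta)
  moreover have "sublist u (encode cs)"
    using assms(4) by (auto simp: cs_def encode_append intro: sublist_order.order.trans)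
  ultimately show ?thesis
    using assms(3) unfolding language_def
    by (auto simp: pmf_positive_iff intro!: exI[of _ "Suc n"] exI[of _ LA] exI[of _ "encode cs"])
qed

lemma finite_language_len: "finite (language_len (\<theta> :: 'a::finite \<Rightarrow> _) l)"
  by (rule finite_subset[OF _ finite_lists_length_eq[of UNIV l]]) (auto simp: language_len_def)

text \<open>Both window laws thus have total mass 1 on the index set of the induced matrix.\<close>

lemma set_window_law:
  assumes "0 < p" "p < 1" "k \<le> 1" "0 < l"
  shows "set_pmf (window_law p l k) \<subseteq> language_len (zeta p) l"
proof
  fix u assume "u \<in> set_pmf (window_law p l k)"
  then obtain bs where bs: "length bs = l" "u = window l k bs"
    by (auto simp: window_law_def set_replicate_pmf)
  have "sublist u (encode bs)"
    unfolding bs window_def by (meson sublist_drop sublist_order.order.trans sublist_take)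
  \<comment> \<open>There are \<open>2 * l\<close> letters, and \<open>k + l \<le> 2 * l\<close>
    because \<open>k \<le> 1 \<le> l\<close>.\<close>
  moreover have "length u = l" using bs assms by (simp add: window_def)
  ultimately show "u \<in> language_len (zeta p) l"
    using assms sublist_encode_in_language by (fastforce simp: language_len_def)
qed

text \<open>As all columns agree and \<open>R\<close> sums to 1, the matrix maps \<open>R\<close> to
  the common column, which is therefore \<open>\<Lambda> * R\<close>. Summing over the legal words
  gives \<open>\<Lambda> = 2\<close>, the mass of two laws.\<close>

lemma right_pf_eigenvector_zeta:
  assumes p: "0 < p" "p < 1" and l: "0 < l"
    and R: "right_pf_eigenvector (language_len (zeta p) l) (induced_matrix (zeta p) l) R"
    and u: "u \<in> language_len (zeta p) l"
  shows "R u = (pmf (window_law p l 0) u + pmf (window_law p l 1) u) / 2"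
proof -
  let ?L = "language_len (zeta p) l"
  define \<Lambda> where "\<Lambda> = pf_eigenvalue ?L (induced_matrix (zeta p) l)"
  have sumR: "(\<Sum>v\<in>?L. R v) = 1"
    using R unfolding right_pf_eigenvector_def by (metis (no_types, lifting) abs_of_pos sum.cong)
  have eigen: "pmf (window_law p l 0) v + pmf (window_law p l 1) v = \<Lambda> * R v" if "v \<in> ?L" for v
  proof -
    have "\<Lambda> * R v = (\<Sum>w\<in>?L. induced_matrix (zeta p) l v w * R w)"
      using R that by (simp add: right_pf_eigenvector_def \<Lambda>_def)
    also have "\<dots> = (\<Sum>w\<in>?L. (pmf (window_law p l 0) v + pmf (window_law p l 1) v) * R w)"
      using l by (intro sum.cong) (auto simp: induced_matrix_zeta language_len_def)
    finally show ?thesis using sumR by (simp flip: sum_distrib_left)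
  qed
  have "(\<Sum>v\<in>?L. pmf (window_law p l 0) v + pmf (window_law p l 1) v) = 2"
    using p l by (simp add: sum.distrib sum_pmf_eq_1 finite_language_len set_window_law)
  then have "\<Lambda> = 2"
    using eigen sumR by (simp flip: sum_distrib_left)
  then show ?thesis using eigen[OF u] by simp
qed

theorem proposition6p7:
  fixes p :: real and \<mu> :: "(int \<Rightarrow> letter) measure"
  assumes "0 < p" and "p < 1"
    and "frequency_measure (zeta p) \<mu>"
  shows "has_metric_entropy (zeta p) \<mu> (- (1 / 2) * (p * ln p + (1 - p) * ln (1 - p)))"
proof -
  define h where "h = pmf_entropy (bernoulli_pmf p)"
  obtain R where
    R: "\<And>l. 1 \<le> l \<Longrightarrow>
      right_pf_eigenvector (language_len (zeta p) l) (induced_matrix (zeta p) l) (R l)"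
    and \<mu>: "\<And>k m v. k \<le> 0 \<Longrightarrow> 0 \<le> m \<Longrightarrow> v \<in> language_len (zeta p) (nat (m - k + 1)) \<Longrightarrow>
      measure \<mu> (cylinder (zeta p) k m v) = R (nat (m - k + 1)) v"
    using assms(3) unfolding frequency_measure_def by blast
  have bounds: "real (n + 1) * h / 2 \<le> block_entropy (zeta p) \<mu> n \<and>
      block_entropy (zeta p) \<mu> n \<le> real (n + 1) * h / 2 + ln 2" if n: "0 < n" for n
  proof -
    have "measure \<mu> (cylinder (zeta p) 0 (int n - 1) w) =
        (pmf (window_law p n 0) w + pmf (window_law p n 1) w) / 2"
      if "w \<in> language_len (zeta p) n" for w
      using \<mu>[of 0 "int n - 1" w] n that right_pf_eigenvector_zeta[OF assms(1,2) n R that]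
      by simp
    note mix = entropy_mixture_bounds[OF finite_language_len
        set_window_law[OF assms(1,2) _ n] set_window_law[OF assms(1,2) _ n] this]
    \<comment> \<open>The numbers of blocks met by the windows at offsets 0 and 1.\<close>
    have "(n + 1) div 2 + (n + 2) div 2 = n + 1"
      by linarith
    then have "real ((0 + n + 1) div 2) + real ((1 + n + 1) div 2) = real (n + 1)"
      by (simp flip: of_nat_add)
    then have "pmf_entropy (window_law p n 0) + pmf_entropy (window_law p n 1) = real (n + 1) * h"
      using n assms by (simp only: entropy_window_law h_def distrib_right[symmetric])
    then show ?thesis
      using mix by (simp add: block_entropy_def)
  qed
  \<comment> \<open>The gap \<open>ln 2\<close> between the bounds does not grow with
    \<open>n\<close>, so it vanishes after division by \<open>n\<close>.\<close>
  have "(\<lambda>n. block_entropy (zeta p) \<mu> n / real n) \<longlonglongrightarrow> h / 2"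
  proof (rule tendsto_sandwich)
    show "\<forall>\<^sub>F n in sequentially. real (n + 1) * h / 2 / real n \<le> block_entropy (zeta p) \<mu> n / real n"
      "\<forall>\<^sub>F n in sequentially. block_entropy (zeta p) \<mu> n / real n \<le> (real (n + 1) * h / 2 + ln 2) / real n"
      using bounds
      by (auto intro!: eventually_mono[OF eventually_gt_at_top[of 0]] divide_right_mono
          simp del: times_divide_eq_left divide_divide_eq_left)
    show "(\<lambda>n. real (n + 1) * h / 2 / real n) \<longlonglongrightarrow> h / 2"
      "(\<lambda>n. (real (n + 1) * h / 2 + ln 2) / real n) \<longlonglongrightarrow> h / 2"
      by real_asymp+
  qed
  moreover have "h / 2 = - (1 / 2) * (p * ln p + (1 - p) * ln (1 - p))"
    using assms(1,2) by (simp add: h_def pmf_entropy_bernoulli field_simps)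
  ultimately show ?thesis
    by (simp only: has_metric_entropy_def)
qed

end
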